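(* Let $G$ be a strongly topological gyrogroup and let $H$ be a closed first-countable and separable strong subgyrogroup of $G$. If the quotient space $G/H$ is a cosmic space, then $G$ is also a cosmic space.
   Context: All topological spaces are assumed Hausdorff. A gyrogroup is a nonempty set $G$ with a binary operation $\oplus$ such that: (G1) there is a unique $0\in G$ with $0\oplus a=a=a\oplus 0$ for all $a$; (G2) each $x\in G$ has a unique inverse $\ominus x$ with $\ominus x\oplus x=0=x\oplus(\ominus x)$; (G3) for all $x,y\in G$ there is an automorphism $\mathrm{gyr}[x,y]$ of $(G,\oplus)$ with $x\oplus(y\oplus z)=(x\oplus y)\oplus\mathrm{gyr}[x,y](z)$ for all $z\in G$; (G4) $\mathrm{gyr}[x\oplus y,y]=\mathrm{gyr}[x,y]$ for all $x,y\in G$. A topological gyrogroup is a gyrogroup with a topology making $\oplus:G\times G\to G$ jointly continuous and $x\mapsto\ominus x$ continuous. It is a strongly topological gyrogroup if there is a neighborhood base $\mathscr U$ of $0$ with $\mathrm{gyr}[x,y](U)=U$ for all $U\in\mathscr U$ and $x,y\in G$. A subgyrogroup is a nonempty subset $H\subseteq G$ that is a gyrogroup under the inherited operation and such that $\mathrm{gyr}[a,b]$ restricts to an automorphism of $H$ for all $a,b\in H$. It is a strong subgyrogroup if $\mathrm{gyr}[x,y](H)=H$ for all $x,y\in G$. For such $H$ the left cosets $a\oplus H$ ($a\in G$) partition $G$; $G/H=\{a\oplus H:a\in G\}$ carries the quotient topology induced by $\pi:G\to G/H$, $\pi(a)=a\oplus H$. Subgyrogroups carry the subspace topology. A network for a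 space $X$ is a family $\mathcal P$ of subsets of $X$ such that for every $x\in X$ and every neighborhood $U$ of $x$ there is $P\in\mathcal P$ with $x\in P\subseteq U$. A cosmic space is a regular space with a countable network. *)

theory Defs
  imports "HOL-Analysis.Analysis"
begin

section \<open>Gyrogroups\<close>

definition magma_automorphism :: "'a set \<Rightarrow> ('a \<Rightarrow> 'a \<Rightarrow> 'a) \<Rightarrow> ('a \<Rightarrow> 'a) \<Rightarrow> bool" where
  "magma_automorphism G add \<phi> \<longleftrightarrow>
     bij_betw \<phi> G G \<and> (\<forall>x\<in>G. \<forall>y\<in>G. \<phi> (add x y) = add (\<phi> x) (\<phi> y))"

text \<open>
  The neutral element, the inversion and the gyrations are parameters rather than being selected
  from the axioms; on \<open>G\<close> all three are determined by \<open>add\<close>. Only their values on \<open>G\<close> matter.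
\<close>

locale gyrogroup =
  fixes G :: "'a set"
    and add :: "'a \<Rightarrow> 'a \<Rightarrow> 'a" (infixl "\<oplus>" 65)
    and zero :: 'a
    and neg :: "'a \<Rightarrow> 'a"
    and gyr :: "'a \<Rightarrow> 'a \<Rightarrow> 'a \<Rightarrow> 'a"
  assumes add_closed: "\<lbrakk>x \<in> G; y \<in> G\<rbrakk> \<Longrightarrow> x \<oplus> y \<in> G"
    and zero_closed: "zero \<in> G"
    and zero_neutral: "a \<in> G \<Longrightarrow> zero \<oplus> a = a \<and> a \<oplus> zero = a"
    and zero_unique: "\<lbrakk>e \<in> G; \<forall>a\<in>G. e \<oplus> a = a \<and> a \<oplus> e = a\<rbrakk> \<Longrightarrow> e = zero"
    and neg_closed: "x \<in> G \<Longrightarrow> neg x \<in> G"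
    and neg_inverse: "x \<in> G \<Longrightarrow> neg x \<oplus> x = zero \<and> x \<oplus> neg x = zero"
    and neg_unique: "\<lbrakk>x \<in> G; y \<in> G; y \<oplus> x = zero \<and> x \<oplus> y = zero\<rbrakk> \<Longrightarrow> y = neg x"
    and gyr_automorphism: "\<lbrakk>x \<in> G; y \<in> G\<rbrakk> \<Longrightarrow> magma_automorphism G add (gyr x y)"
    and gyr_assoc: "\<lbrakk>x \<in> G; y \<in> G; z \<in> G\<rbrakk> \<Longrightarrow> x \<oplus> (y \<oplus> z) = (x \<oplus> y) \<oplus> gyr x y z"
    and gyr_loop: "\<lbrakk>x \<in> G; y \<in> G; z \<in> G\<rbrakk> \<Longrightarrow> gyr (x \<oplus> y) y z = gyr x y z"

text \<open>\<open>add\<close> and \<open>gyr\<close> are those of the ambient gyrogroup with carrier \<open>G\<close>.\<close>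

definition subgyrogroup ::
    "'a set \<Rightarrow> ('a \<Rightarrow> 'a \<Rightarrow> 'a) \<Rightarrow> ('a \<Rightarrow> 'a \<Rightarrow> 'a \<Rightarrow> 'a) \<Rightarrow> 'a set \<Rightarrow> bool" where
  "subgyrogroup G add gyr H \<longleftrightarrow>
     H \<noteq> {} \<and> H \<subseteq> G \<and>
     (\<exists>zero' neg' gyr'. gyrogroup H add zero' neg' gyr') \<and>
     (\<forall>a\<in>H. \<forall>b\<in>H. magma_automorphism H add (gyr a b))"

definition strong_subgyrogroup ::
    "'a set \<Rightarrow> ('a \<Rightarrow> 'a \<Rightarrow> 'a) \<Rightarrow> ('a \<Rightarrow> 'a \<Rightarrow> 'a \<Rightarrow> 'a) \<Rightarrow> 'a set \<Rightarrow> bool" where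
  "strong_subgyrogroup G add gyr H \<longleftrightarrow>
     subgyrogroup G add gyr H \<and> (\<forall>x\<in>G. \<forall>y\<in>G. gyr x y ` H = H)"

definition left_coset :: "('a \<Rightarrow> 'a \<Rightarrow> 'a) \<Rightarrow> 'a set \<Rightarrow> 'a \<Rightarrow> 'a set" where
  "left_coset add H a = add a ` H"


section \<open>Topological notions\<close>

text \<open>Neighbourhoods need not be open.\<close>

definition neighbourhood :: "'a topology \<Rightarrow> 'a \<Rightarrow> 'a set \<Rightarrow> bool" where
  "neighbourhood X x N \<longleftrightarrow> N \<subseteq> topspace X \<and> (\<exists>V. openin X V \<and> x \<in> V \<and> V \<subseteq> N)"

definition neighbourhood_base :: "'a topology \<Rightarrow> 'a \<Rightarrow> 'a set set \<Rightarrow> bool" where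
  "neighbourhood_base X x \<U> \<longleftrightarrow>
     (\<forall>U\<in>\<U>. neighbourhood X x U) \<and>
     (\<forall>N. neighbourhood X x N \<longrightarrow> (\<exists>U\<in>\<U>. U \<subseteq> N))"

definition network :: "'a topology \<Rightarrow> 'a set set \<Rightarrow> bool" where
  "network X \<P> \<longleftrightarrow>
     (\<forall>P\<in>\<P>. P \<subseteq> topspace X) \<and>
     (\<forall>x\<in>topspace X. \<forall>U. neighbourhood X x U \<longrightarrow> (\<exists>P\<in>\<P>. x \<in> P \<and> P \<subseteq> U))"

text \<open>All spaces are assumed Hausdorff; the library's \<open>regular_space\<close> does not include this.\<close>

definition cosmic_space :: "'a topology \<Rightarrow> bool" where
  "cosmic_space X \<longleftrightarrow>
     Hausdorff_space X \<and> regular_space X \<and> (\<exists>\<P>. countable \<P> \<and> network X \<P>)"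

definition quotient_topology :: "'a topology \<Rightarrow> ('a \<Rightarrow> 'b) \<Rightarrow> 'b topology" where
  "quotient_topology X p =
     topology (\<lambda>V. V \<subseteq> p ` topspace X \<and> openin X {x \<in> topspace X. p x \<in> V})"

lemma openin_quotient_topology:
  "openin (quotient_topology X p) V \<longleftrightarrow>
     V \<subseteq> p ` topspace X \<and> openin X {x \<in> topspace X. p x \<in> V}"
proof -
  have "istopology (\<lambda>V. V \<subseteq> p ` topspace X \<and> openin X {x \<in> topspace X. p x \<in> V})"
    unfolding istopology_def
  proof (intro conjI allI impI)
    fix S T
    assume "S \<subseteq> p ` topspace X \<and> openin X {x \<in> topspace X. p x \<in> S}"
      and "T \<subseteq> p ` topspace X \<and> openin X {x \<in> topspace X. p x \<in> T}"
    moreover have "{x \<in> topspace X. p x \<in> S \<inter> T} =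
        {x \<in> topspace X. p x \<in> S} \<inter> {x \<in> topspace X. p x \<in> T}" by auto
    ultimately show "S \<inter> T \<subseteq> p ` topspace X" "openin X {x \<in> topspace X. p x \<in> S \<inter> T}"
      by auto
  next
    fix \<K>
    assume "\<forall>K\<in>\<K>. K \<subseteq> p ` topspace X \<and> openin X {x \<in> topspace X. p x \<in> K}"
    moreover have "{x \<in> topspace X. p x \<in> \<Union>\<K>} = (\<Union>K\<in>\<K>. {x \<in> topspace X. p x \<in> K})" by auto
    ultimately show "\<Union>\<K> \<subseteq> p ` topspace X" "openin X {x \<in> topspace X. p x \<in> \<Union>\<K>}"
      by auto
  qed
  then show ?thesis
    by (simp add: quotient_topology_def topology_inverse')
qed

lemma topspace_quotient_topology: "topspace (quotient_topology X p) = p ` topspace X"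
proof
  show "topspace (quotient_topology X p) \<subseteq> p ` topspace X"
    by (auto simp: topspace_def[of "quotient_topology X p"] openin_quotient_topology)
  have "{x \<in> topspace X. p x \<in> p ` topspace X} = topspace X" by auto
  then show "p ` topspace X \<subseteq> topspace (quotient_topology X p)"
    by (intro openin_subset) (simp add: openin_quotient_topology)
qed

lemma quotient_map_quotient_topology: "quotient_map X (quotient_topology X p) p"
  by (simp add: quotient_map_def topspace_quotient_topology openin_quotient_topology)

text \<open>The left coset space \<open>G/H\<close>, for a topology \<open>T\<close> on \<open>G\<close>.\<close>

definition coset_space :: "'a topology \<Rightarrow> ('a \<Rightarrow> 'a \<Rightarrow> 'a) \<Rightarrow> 'a set \<Rightarrow> 'a set topology" where
  "coset_space T add H = quotient_topology T (left_coset add H)"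


section \<open>Topological gyrogroups\<close>

locale topological_gyrogroup =
  gyrogroup "topspace T" add zero neg gyr
  for T :: "'a topology"
    and add :: "'a \<Rightarrow> 'a \<Rightarrow> 'a" (infixl "\<oplus>" 65)
    and zero :: 'a
    and neg :: "'a \<Rightarrow> 'a"
    and gyr :: "'a \<Rightarrow> 'a \<Rightarrow> 'a \<Rightarrow> 'a" +
  assumes Hausdorff: "Hausdorff_space T"
    and continuous_add: "continuous_map (prod_topology T T) T (\<lambda>(x, y). x \<oplus> y)"
    and continuous_neg: "continuous_map T T neg"

locale strongly_topological_gyrogroup = topological_gyrogroup +
  assumes gyr_invariant_base:
    "\<exists>\<U>. neighbourhood_base T zero \<U> \<and>
         (\<forall>U\<in>\<U>. \<forall>x\<in>topspace T. \<forall>y\<in>topspace T. gyr x y ` U = U)"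

end

theory Submission
  imports Defs
begin

text \<open>
  Let \<open>\<P>\<close> be a countable network of \<open>G/H\<close>, and choose countably many neighbourhoods \<open>V\<^sub>n\<close> of zero
  such that the sets \<open>H \<inter> (\<ominus>V\<^sub>n \<oplus> gyr[a,b](\<ominus>V\<^sub>n \<oplus> V\<^sub>n))\<close> shrink to zero inside \<open>H\<close>, uniformly in
  \<open>a, b \<in> G\<close>; the invariant base at zero provides them. As \<open>H\<close> and \<open>G/H\<close> are separable, so is \<open>G\<close>;
  let \<open>B\<close> be countable and dense. Then the sets \<open>\<pi>\<^sup>-\<^sup>1(P) \<inter> (b \<oplus> V\<^sub>n)\<close> form a network: given \<open>x\<close>,
  choose \<open>b\<close> with \<open>x \<in> b \<oplus> V\<^sub>n\<close> and \<open>P\<close> inside the image of a neighbourhood \<open>x \<oplus> W\<close> with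
  \<open>W \<subseteq> V\<^sub>n\<close>. Every member is \<open>y = x \<oplus> (w \<oplus> h)\<close> with \<open>w \<in> W\<close> and \<open>h \<in> H\<close>. Writing \<open>x = b \<oplus> u\<close> and
  \<open>y = b \<oplus> v\<close> with \<open>u, v \<in> V\<^sub>n\<close> gives \<open>h = \<ominus>w \<oplus> gyr[b,u](\<ominus>u \<oplus> v)\<close>, so \<open>h\<close> is small.
\<close>

section \<open>General topology: square neighbourhoods and countable networks\<close>

lemma continuous_map_square_neighbourhood:
  assumes "continuous_map (prod_topology X X) Y f" "openin Y U" "a \<in> topspace X" "f (a, a) \<in> U"
  obtains V where "openin X V" "a \<in> V" "\<And>u v. u \<in> V \<Longrightarrow> v \<in> V \<Longrightarrow> f (u, v) \<in> U"
proof -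
  have "openin (prod_topology X X) {p \<in> topspace (prod_topology X X). f p \<in> U}"
    using assms(1,2) by (rule openin_continuous_map_preimage)
  moreover have "(a, a) \<in> {p \<in> topspace (prod_topology X X). f p \<in> U}"
    using assms(3,4) by simp
  ultimately obtain A B where "openin X A" "openin X B" "a \<in> A" "a \<in> B"
    and "A \<times> B \<subseteq> {p \<in> topspace (prod_topology X X). f p \<in> U}"
    unfolding openin_prod_topology_alt by meson
  then show thesis
    by (intro that[of "A \<inter> B"]) auto
qed

text \<open>One point picked from each nonempty member suffices, because every nonempty open set
  contains such a member.\<close>

lemma network_imp_countable_dense:
  assumes "countable \<P>" "network X \<P>"
  obtains D where "countable D" "D \<subseteq> topspace X" "\<And>U. openin X U \<Longrightarrow> U \<noteq> {} \<Longrightarrow> D \<inter> U \<noteq> {}"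
proof
  let ?D = "(\<lambda>P. SOME p. p \<in> P) ` (\<P> - {{}})"
  show "countable ?D"
    using assms(1) by simp
  have pick: "(SOME p. p \<in> P) \<in> P" if "P \<noteq> {}" for P :: "'a set"
    using that by (simp add: some_in_eq)
  show "?D \<subseteq> topspace X"
    using assms(2) pick unfolding network_def by blast
  fix U assume U: "openin X U" "U \<noteq> {}"
  then obtain u where "u \<in> U"
    by blast
  moreover have "neighbourhood X u U"
    using U(1) \<open>u \<in> U\<close> openin_subset unfolding neighbourhood_def by blast
  moreover have "u \<in> topspace X"
    using U(1) \<open>u \<in> U\<close> openin_subset by blast
  ultimately obtain P where "P \<in> \<P>" "u \<in> P" "P \<subseteq> U"
    using assms(2) unfolding network_def by blast
  then show "?D \<inter> U \<noteq> {}"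
    using pick[of P] by blast
qed

lemma topspace_coset_space: "topspace (coset_space T add H) = left_coset add H ` topspace T"
  by (simp add: coset_space_def topspace_quotient_topology)

section \<open>Gyrogroup algebra: cancellation laws and cosets\<close>

context gyrogroup
begin

lemma gyr_closed:
  assumes "x \<in> G" "y \<in> G" "z \<in> G"
  shows "gyr x y z \<in> G"
  using gyr_automorphism[OF assms(1,2)] assms(3)
  unfolding magma_automorphism_def bij_betw_def by blast

lemma gyr_inj:
  assumes "x \<in> G" "y \<in> G" "u \<in> G" "v \<in> G" "gyr x y u = gyr x y v"
  shows "u = v"
  using gyr_automorphism[OF assms(1,2)] assms(3-5)
  unfolding magma_automorphism_def bij_betw_def inj_on_def by blast

text \<open>Adding \<open>neg a\<close> on the left turns \<open>a \<oplus> z\<close> into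
  \<open>gyr (neg a) a z\<close>, and gyrations are injective.\<close>

lemma left_cancel:
  assumes "a \<in> G" "u \<in> G" "v \<in> G" "a \<oplus> u = a \<oplus> v"
  shows "u = v"
proof -
  have "neg a \<oplus> (a \<oplus> z) = gyr (neg a) a z" if "z \<in> G" for z
    using that assms(1) by (simp add: gyr_assoc neg_closed neg_inverse zero_neutral gyr_closed)
  from this[of u] this[of v] have "gyr (neg a) a u = gyr (neg a) a v"
    using assms by simp
  then show ?thesis
    using assms(1-3) by (intro gyr_inj[of "neg a" a u v] neg_closed)
qed

text \<open>The loop property identifies \<open>gyr (neg a) a\<close> with
  \<open>gyr zero a\<close>, which is trivial by left cancellation.\<close>

lemma gyr_neg_self:
  assumes "a \<in> G" "z \<in> G"
  shows "gyr (neg a) a z = z"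
proof -
  have "zero \<oplus> (a \<oplus> z) = (zero \<oplus> a) \<oplus> gyr zero a z"
    using assms zero_closed by (intro gyr_assoc)
  then have "a \<oplus> z = a \<oplus> gyr zero a z"
    using assms by (simp add: zero_neutral add_closed)
  then have "gyr zero a z = z"
    using left_cancel[of a z "gyr zero a z"] assms by (simp add: zero_closed gyr_closed)
  then show ?thesis
    using gyr_loop[of "neg a" a z] assms by (simp add: neg_closed neg_inverse)
qed

lemma neg_add_cancel:
  assumes "a \<in> G" "b \<in> G"
  shows "neg a \<oplus> (a \<oplus> b) = b"
  using assms by (simp add: gyr_assoc neg_closed neg_inverse gyr_neg_self zero_neutral)

lemma add_neg_cancel:
  assumes "a \<in> G" "b \<in> G"
  shows "a \<oplus> (neg a \<oplus> b) = b"
proof -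
  have "a = neg (neg a)"
    using assms neg_inverse by (intro neg_unique neg_closed) auto
  then show ?thesis
    using neg_add_cancel[of "neg a" b] assms neg_closed by simp
qed

text \<open>An invariant set absorbs the gyration: reassociating to the right only replaces
  \<open>s\<close> by its preimage \<open>t\<close>, still in \<open>S\<close>. It is applied to
  \<open>H\<close> and to invariant neighbourhoods of zero.\<close>

lemma add_assoc_gyr_preimage:
  assumes "x \<in> G" "y \<in> G" "S \<subseteq> G" "gyr x y ` S = S" "s \<in> S"
  obtains t where "t \<in> S" "(x \<oplus> y) \<oplus> s = x \<oplus> (y \<oplus> t)"
proof -
  have "s \<in> gyr x y ` S"
    using assms(4,5) by simp
  then obtain t where t: "t \<in> S" "gyr x y t = s"
    by auto
  then have "(x \<oplus> y) \<oplus> s = x \<oplus> (y \<oplus> t)"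
    using gyr_assoc[of x y t] assms(1-3) by auto
  with t(1) show thesis
    by (rule that)
qed

lemma add_neg_right_cancel:
  assumes "x \<in> G" "y \<in> G"
  shows "(x \<oplus> y) \<oplus> gyr x y (neg y) = x"
  using gyr_assoc[of x y "neg y"] assms by (simp add: neg_closed neg_inverse zero_neutral)

lemma strong_subgyrogroupD:
  assumes "strong_subgyrogroup G add gyr H"
  shows "subgyrogroup G add gyr H" "H \<subseteq> G"
    and "x \<in> G \<Longrightarrow> y \<in> G \<Longrightarrow> gyr x y ` H = H"
  using assms unfolding strong_subgyrogroup_def subgyrogroup_def by simp_all

text \<open>The neutral element of \<open>H\<close> is idempotent, so cancelling it on the left
  makes it equal to \<open>zero\<close>.\<close>

lemma subgyrogroup_zero_mem:
  assumes "subgyrogroup G add gyr H"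
  shows "zero \<in> H"
proof -
  obtain zero' neg' gyr' where H: "H \<subseteq> G" and "gyrogroup H add zero' neg' gyr'"
    using assms unfolding subgyrogroup_def by blast
  then interpret H: gyrogroup H add zero' neg' gyr'
    by simp
  have "zero' \<in> G" "zero' \<oplus> zero' = zero' \<oplus> zero"
    using H H.zero_closed H.zero_neutral zero_neutral by auto
  then have "zero' = zero"
    using left_cancel zero_closed by blast
  then show ?thesis
    using H.zero_closed by simp
qed

lemma subgyrogroup_add_closed:
  assumes "subgyrogroup G add gyr H" "x \<in> H" "y \<in> H"
  shows "x \<oplus> y \<in> H"
  using assms gyrogroup.add_closed unfolding subgyrogroup_def by metis

lemma subgyrogroup_neg_closed:
  assumes "subgyrogroup G add gyr H" "h \<in> H"
  shows "neg h \<in> H"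
proof -
  obtain zero' neg' gyr' where H: "H \<subseteq> G" and "gyrogroup H add zero' neg' gyr'"
    using assms(1) unfolding subgyrogroup_def by blast
  then interpret H: gyrogroup H add zero' neg' gyr'
    by simp
  have "zero' = zero"
    using H.zero_unique[of zero] subgyrogroup_zero_mem[OF assms(1)] H zero_neutral by auto
  then have "neg' h = neg h"
    using H H.neg_inverse H.neg_closed assms(2) by (intro neg_unique) auto
  then show ?thesis
    using H.neg_closed assms(2) by metis
qed

text \<open>Since \<open>gyr y k\<close> permutes \<open>H\<close>, the coset of
  \<open>y \<oplus> k\<close> consists of the points \<open>(y \<oplus> k) \<oplus> gyr y k h = y
  \<oplus> (k \<oplus> h)\<close>, and translation by \<open>k\<close> maps \<open>H\<close> onto
  itself.\<close>

lemma left_coset_add: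
  assumes H: "strong_subgyrogroup G add gyr H" and "y \<in> G" "k \<in> H"
  shows "left_coset add H (y \<oplus> k) = left_coset add H y"
proof -
  have sub: "subgyrogroup G add gyr H" "H \<subseteq> G" and inv: "gyr y k ` H = H"
    using strong_subgyrogroupD[OF H] assms(2,3) by blast+
  have "k \<oplus> (neg k \<oplus> h) = h" "neg k \<oplus> h \<in> H" if "h \<in> H" for h
    using that sub assms(3)
    by (auto intro!: add_neg_cancel subgyrogroup_add_closed subgyrogroup_neg_closed)
  then have "add k ` H = H"
    using subgyrogroup_add_closed[OF sub(1) assms(3)] by force
  have "add (y \<oplus> k) ` H = add (y \<oplus> k) ` gyr y k ` H"
    using inv by simp
  also have "\<dots> = add y ` add k ` H"
    unfolding image_image using sub(2) assms(2,3)
    by (intro image_cong refl gyr_assoc[symmetric]) auto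
  finally show ?thesis
    using \<open>add k ` H = H\<close> by (simp add: left_coset_def)
qed

lemma mem_left_coset_self:
  assumes "subgyrogroup G add gyr H" "y \<in> G"
  shows "y \<in> left_coset add H y"
  using subgyrogroup_zero_mem[OF assms(1)] zero_neutral[OF assms(2)]
  unfolding left_coset_def by force

end

section \<open>Openness of the coset projection and separability\<close>

context topological_gyrogroup
begin

lemma continuous_map_add [continuous_intros]:
  assumes "continuous_map X T f" "continuous_map X T g"
  shows "continuous_map X T (\<lambda>x. f x \<oplus> g x)"
  using continuous_map_compose[OF continuous_map_pairedI[OF assms] continuous_add]
  by (simp add: o_def)

lemma continuous_map_neg [continuous_intros]:
  assumes "continuous_map X T f"
  shows "continuous_map X T (\<lambda>x. neg (f x))"
  using continuous_map_compose[OF assms continuous_neg] by (simp add: o_def)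

lemma openin_left_translate:
  assumes "x \<in> topspace T" "openin T W"
  shows "openin T {y \<in> topspace T. neg x \<oplus> y \<in> W}"
  using assms
  by (intro openin_continuous_map_preimage[OF _ assms(2)] continuous_map_add)
    (auto simp: neg_closed)

text \<open>The saturation of \<open>U\<close> is the union over \<open>k \<in> H\<close> of the
  preimages of \<open>U\<close> under right translation by \<open>k\<close>, each of which is
  open.\<close>

lemma openin_coset_space_image:
  assumes H: "strong_subgyrogroup (topspace T) add gyr H" and U: "openin T U"
  shows "openin (coset_space T add H) (left_coset add H ` U)"
proof -
  let ?\<pi> = "left_coset add H"
  have sub: "subgyrogroup (topspace T) add gyr H" "H \<subseteq> topspace T"
    using strong_subgyrogroupD[OF H] by blast+
  have UT: "U \<subseteq> topspace T"
    using U openin_subset by blast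
  have "{y \<in> topspace T. ?\<pi> y \<in> ?\<pi> ` U} = (\<Union>k\<in>H. {y \<in> topspace T. y \<oplus> k \<in> U})"
  proof (intro equalityI subsetI)
    fix y assume "y \<in> {y \<in> topspace T. ?\<pi> y \<in> ?\<pi> ` U}"
    then obtain u where u: "y \<in> topspace T" "u \<in> U" "?\<pi> y = ?\<pi> u"
      by auto
    then have "u \<in> ?\<pi> y"
      using mem_left_coset_self[OF sub(1), of u] UT by auto
    then show "y \<in> (\<Union>k\<in>H. {y \<in> topspace T. y \<oplus> k \<in> U})"
      using u(1,2) unfolding left_coset_def by auto
  next
    fix y assume "y \<in> (\<Union>k\<in>H. {y \<in> topspace T. y \<oplus> k \<in> U})"
    then show "y \<in> {y \<in> topspace T. ?\<pi> y \<in> ?\<pi> ` U}"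
      using left_coset_add[OF H] by blast
  qed
  moreover have "openin T {y \<in> topspace T. y \<oplus> k \<in> U}" if "k \<in> H" for k
    using that sub(2)
    by (intro openin_continuous_map_preimage[OF _ U] continuous_map_add) auto
  ultimately have "openin T {y \<in> topspace T. ?\<pi> y \<in> ?\<pi> ` U}"
    by auto
  then show ?thesis
    using UT unfolding coset_space_def openin_quotient_topology by blast
qed

text \<open>Representatives \<open>A\<close> of a countable dense set of cosets are translated by a
  countable dense subset \<open>D\<close> of \<open>H\<close>. Openness of the projection gives some
  \<open>a \<in> A\<close> whose coset meets \<open>U\<close>; pulling \<open>U\<close> back to
  \<open>H\<close> along \<open>a\<close> then gives some \<open>d \<in> D\<close>.\<close>

lemma coset_space_countable_dense:
  assumes H: "strong_subgyrogroup (topspace T) add gyr H"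
    and sep: "separable_space (subtopology T H)"
    and "countable \<P>" "network (coset_space T add H) \<P>"
  obtains B where "countable B" "B \<subseteq> topspace T" "\<And>U. openin T U \<Longrightarrow> U \<noteq> {} \<Longrightarrow> B \<inter> U \<noteq> {}"
proof -
  let ?\<pi> = "left_coset add H"
  have sub: "subgyrogroup (topspace T) add gyr H" "H \<subseteq> topspace T"
    using strong_subgyrogroupD[OF H] by blast+
  obtain Q where Q: "countable Q" "Q \<subseteq> ?\<pi> ` topspace T"
    and Qd: "\<And>U. openin (coset_space T add H) U \<Longrightarrow> U \<noteq> {} \<Longrightarrow> Q \<inter> U \<noteq> {}"
    using network_imp_countable_dense[OF assms(3,4)] unfolding topspace_coset_space by blast
  obtain A where A: "countable A" "A \<subseteq> topspace T" "Q = ?\<pi> ` A"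
    using Q countable_subset_image[of Q ?\<pi> "topspace T"] by blast
  obtain D where D: "countable D" "D \<subseteq> H"
    and Dd: "\<And>U. openin (subtopology T H) U \<Longrightarrow> U \<noteq> {} \<Longrightarrow> D \<inter> U \<noteq> {}"
    using sep sub(2) unfolding separable_space_def dense_intersects_open
    by (metis inf_absorb2 topspace_subtopology)
  show thesis
  proof
    let ?B = "(\<lambda>(a, d). a \<oplus> d) ` (A \<times> D)"
    show "countable ?B"
      using A(1) D(1) by simp
    show "?B \<subseteq> topspace T"
      using A(2) D(2) sub(2) by (auto intro!: add_closed)
    fix U assume U: "openin T U" "U \<noteq> {}"
    then obtain a u where a: "a \<in> A" "u \<in> U" "?\<pi> a = ?\<pi> u"
      using Qd[OF openin_coset_space_image[OF H U(1)]] A(3) by blast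
    then have aT: "a \<in> topspace T" "u \<in> topspace T"
      using A(2) U(1) openin_subset by blast+
    then have "u \<in> ?\<pi> a"
      using mem_left_coset_self[OF sub(1), of u] a(3) by simp
    then obtain k where k: "k \<in> H" "a \<oplus> k = u"
      unfolding left_coset_def by auto
    have "openin (subtopology T H) {h \<in> topspace (subtopology T H). a \<oplus> h \<in> U}"
      using aT by (intro openin_continuous_map_preimage[OF _ U(1)] continuous_map_add)
        (auto intro: continuous_map_from_subtopology)
    moreover have "k \<in> {h \<in> topspace (subtopology T H). a \<oplus> h \<in> U}"
      using k a sub(2) by auto
    ultimately obtain d where "d \<in> D" "a \<oplus> d \<in> U"
      using Dd by blast
    then show "?B \<inter> U \<noteq> {}"
      using a(1) by force
  qed
qed

end

section \<open>Gyration-invariant neighbourhoods and regularity\<close>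

context strongly_topological_gyrogroup
begin

text \<open>Members of the invariant base need not be open, so an open \<open>W\<close> is supplied
  inside the invariant \<open>V\<close>.\<close>

lemma invariant_neighbourhood:
  assumes "openin T U" "zero \<in> U"
  obtains V W where "openin T W" "zero \<in> W" "W \<subseteq> V" "V \<subseteq> U"
    "\<And>x y. x \<in> topspace T \<Longrightarrow> y \<in> topspace T \<Longrightarrow> gyr x y ` V = V"
proof -
  have "neighbourhood T zero U"
    using assms openin_subset unfolding neighbourhood_def by blast
  then show thesis
    using that gyr_invariant_base unfolding neighbourhood_base_def neighbourhood_def by metis
qed

lemma add_add_neighbourhood:
  assumes "openin T U" "x \<in> U"
  obtains W where "openin T W" "zero \<in> W" "\<And>u v. u \<in> W \<Longrightarrow> v \<in> W \<Longrightarrow> x \<oplus> (u \<oplus> v) \<in> U"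
proof -
  have x: "x \<in> topspace T"
    using assms openin_subset by blast
  have "continuous_map (prod_topology T T) T (\<lambda>p. x \<oplus> (fst p \<oplus> snd p))"
    using x by (intro continuous_map_add continuous_map_fst continuous_map_snd) auto
  from continuous_map_square_neighbourhood[OF this assms(1) zero_closed] show thesis
    using that assms(2) x zero_closed zero_neutral by auto
qed

lemma neg_add_neighbourhood:
  assumes "openin T U" "zero \<in> U"
  obtains W where "openin T W" "zero \<in> W" "\<And>u v. u \<in> W \<Longrightarrow> v \<in> W \<Longrightarrow> neg u \<oplus> v \<in> U"
proof -
  have "continuous_map (prod_topology T T) T (\<lambda>p. neg (fst p) \<oplus> snd p)"
    by (intro continuous_map_add continuous_map_neg continuous_map_fst continuous_map_snd)
  from continuous_map_square_neighbourhood[OF this assms(1) zero_closed] show thesis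
    using that assms(2) neg_inverse[OF zero_closed] by auto
qed

lemma regular_space: "regular_space T"
  unfolding neighbourhood_base_of_closedin[symmetric] neighbourhood_base_of
proof (intro allI impI)
  fix U x assume U: "openin T U \<and> x \<in> U"
  then have x: "x \<in> topspace T"
    using openin_subset by blast
  obtain W1 where W1: "openin T W1" "zero \<in> W1"
    and sum: "\<And>u v. u \<in> W1 \<Longrightarrow> v \<in> W1 \<Longrightarrow> x \<oplus> (u \<oplus> v) \<in> U"
    using add_add_neighbourhood U by blast
  obtain V W where W: "openin T W" "zero \<in> W" "W \<subseteq> V" "V \<subseteq> W1"
    and inv: "\<And>x y. x \<in> topspace T \<Longrightarrow> y \<in> topspace T \<Longrightarrow> gyr x y ` V = V"
    by (rule invariant_neighbourhood[OF W1]) (rule that)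
  have VT: "V \<subseteq> topspace T"
    using W(4) W1(1) openin_subset by blast
  obtain W' where W': "openin T W'" "zero \<in> W'"
    and diff: "\<And>u v. u \<in> W' \<Longrightarrow> v \<in> W' \<Longrightarrow> neg u \<oplus> v \<in> W"
    using neg_add_neighbourhood W(1,2) by blast
  have W'T: "W' \<subseteq> topspace T"
    using W'(1) openin_subset by blast
  let ?A = "{y \<in> topspace T. neg x \<oplus> y \<in> W}"
  have A: "openin T ?A" "x \<in> ?A"
    using openin_left_translate W(1,2) x neg_inverse by auto
  \<comment> \<open>A closure point \<open>y\<close> has a translate \<open>y \<oplus> v\<close> in
    \<open>?A\<close> with \<open>v \<in> W'\<close>. Cancelling \<open>v\<close> from the right, up
    to a gyration, writes \<open>y\<close> as \<open>x\<close> plus a sum of two elements of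
    \<open>W1\<close>.\<close>
  have "T closure_of ?A \<subseteq> U"
  proof
    fix y assume y: "y \<in> T closure_of ?A"
    then have yT: "y \<in> topspace T"
      using closure_of_subset_topspace by fast
    have "openin T {z \<in> topspace T. neg y \<oplus> z \<in> W'}" "y \<in> {z \<in> topspace T. neg y \<oplus> z \<in> W'}"
      using openin_left_translate W'(1,2) yT neg_inverse by auto
    moreover have "\<And>N. y \<in> N \<Longrightarrow> openin T N \<Longrightarrow> \<exists>z. z \<in> ?A \<and> z \<in> N"
      using y unfolding in_closure_of by simp
    ultimately have "\<exists>z. z \<in> ?A \<and> z \<in> {z \<in> topspace T. neg y \<oplus> z \<in> W'}"
      by presburger
    then obtain z where z: "z \<in> topspace T" "neg x \<oplus> z \<in> W" "neg y \<oplus> z \<in> W'"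
      by auto
    define v where "v = neg y \<oplus> z"
    have v: "v \<in> topspace T" "z = y \<oplus> v"
      using z yT by (auto simp: v_def add_closed neg_closed add_neg_cancel)
    \<comment> \<open>The difference bound for \<open>v\<close> and \<open>zero\<close> yields the
      inverse alone.\<close>
    have "neg v \<in> W"
      using diff[OF z(3)[folded v_def] W'(2)] zero_neutral[OF neg_closed[OF v(1)]] by simp
    then have g: "gyr y v (neg v) \<in> V"
      using imageI[of "neg v" V "gyr y v"] inv[OF yT v(1)] W(3) by auto
    have s: "neg x \<oplus> z \<in> topspace T" "x \<oplus> (neg x \<oplus> z) = z"
      using z x by (auto simp: add_closed neg_closed add_neg_cancel)
    \<comment> \<open>This reassociation involves the gyration of \<open>x\<close> and
      \<open>neg x \<oplus> z\<close>, while the element being moved carries that of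
      \<open>y\<close> and \<open>v\<close>; \<open>V\<close> is invariant under both.\<close>
    obtain t where t: "t \<in> V"
      "(x \<oplus> (neg x \<oplus> z)) \<oplus> gyr y v (neg v) = x \<oplus> ((neg x \<oplus> z) \<oplus> t)"
      by (rule add_assoc_gyr_preimage[OF x s(1) VT inv[OF x s(1)] g]) (rule that)
    have "(x \<oplus> (neg x \<oplus> z)) \<oplus> gyr y v (neg v) = y"
      using add_neg_right_cancel[OF yT v(1)] v(2) s(2) by simp
    then have "x \<oplus> ((neg x \<oplus> z) \<oplus> t) = y"
      using t(2) by simp
    moreover have "neg x \<oplus> z \<in> W1" "t \<in> W1"
      using z(2) t(1) W(3,4) by auto
    ultimately show "y \<in> U"
      using sum by metis
  qed
  then show "\<exists>A C. openin T A \<and> closedin T C \<and> x \<in> A \<and> A \<subseteq> C \<and> C \<subseteq> U"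
    using A closure_of_subset[OF openin_subset[OF A(1)]] by (meson closedin_closure_of)
qed

text \<open>
  Continuity alone cannot control the gyration here, since \<open>x\<close> and \<open>y\<close> range over all of \<open>G\<close>.
\<close>

lemma invariant_difference_neighbourhood:
  assumes "openin T U" "zero \<in> U"
  obtains V where "openin T V" "zero \<in> V"
    "\<And>w u v x y. \<lbrakk>w \<in> V; u \<in> V; v \<in> V; x \<in> topspace T; y \<in> topspace T\<rbrakk>
      \<Longrightarrow> neg w \<oplus> gyr x y (neg u \<oplus> v) \<in> U"
proof -
  obtain W1 where W1: "openin T W1" "zero \<in> W1"
    and d1: "\<And>u v. u \<in> W1 \<Longrightarrow> v \<in> W1 \<Longrightarrow> neg u \<oplus> v \<in> U"
    using neg_add_neighbourhood assms by blast
  obtain I W where W: "openin T W" "zero \<in> W" "W \<subseteq> I" "I \<subseteq> W1"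
    and inv: "\<And>x y. x \<in> topspace T \<Longrightarrow> y \<in> topspace T \<Longrightarrow> gyr x y ` I = I"
    by (rule invariant_neighbourhood[OF W1]) (rule that)
  obtain W2 where W2: "openin T W2" "zero \<in> W2"
    and d2: "\<And>u v. u \<in> W2 \<Longrightarrow> v \<in> W2 \<Longrightarrow> neg u \<oplus> v \<in> W"
    using neg_add_neighbourhood W(1,2) by blast
  show thesis
  proof
    show "openin T (W1 \<inter> W2)" "zero \<in> W1 \<inter> W2"
      using W1 W2 by auto
    fix w u v x y assume "w \<in> W1 \<inter> W2" "u \<in> W1 \<inter> W2" "v \<in> W1 \<inter> W2"
      and xy: "x \<in> topspace T" "y \<in> topspace T"
    then have "neg u \<oplus> v \<in> I" "w \<in> W1"
      using d2 W(3) by blast+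
    \<comment> \<open>The invariant set \<open>I\<close> between \<open>W\<close> and
      \<open>W1\<close> absorbs the gyration for all \<open>x\<close> and \<open>y\<close> at
      once.\<close>
    then have "gyr x y (neg u \<oplus> v) \<in> W1"
      using imageI[of "neg u \<oplus> v" I "gyr x y"] inv[OF xy] W(4) by auto
    then show "neg w \<oplus> gyr x y (neg u \<oplus> v) \<in> U"
      using d1 \<open>w \<in> W1\<close> by simp
  qed
qed

section \<open>A countable network from cosets and small translates\<close>

lemma coset_space_countable_network:
  assumes H: "strong_subgyrogroup (topspace T) add gyr H"
    and fc: "first_countable (subtopology T H)"
    and sep: "separable_space (subtopology T H)"
    and P: "countable \<P>" "network (coset_space T add H) \<P>"
  shows "\<exists>\<N>. countable \<N> \<and> network T \<N>"
proof -
  let ?\<pi> = "left_coset add H"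
  have sub: "subgyrogroup (topspace T) add gyr H" "H \<subseteq> topspace T"
    and Hinv: "\<And>x y. x \<in> topspace T \<Longrightarrow> y \<in> topspace T \<Longrightarrow> gyr x y ` H = H"
    using strong_subgyrogroupD[OF H] by blast+
  have zH: "zero \<in> topspace (subtopology T H)"
    using subgyrogroup_zero_mem[OF sub(1)] sub(2) by auto
  obtain B where B: "countable B" "B \<subseteq> topspace T"
    and Bd: "\<And>U. openin T U \<Longrightarrow> U \<noteq> {} \<Longrightarrow> B \<inter> U \<noteq> {}"
    using coset_space_countable_dense[OF H sep P] by blast
  obtain \<B> where \<B>: "countable \<B>" "\<And>N. N \<in> \<B> \<Longrightarrow> openin (subtopology T H) N"
    and base: "\<And>U. openin (subtopology T H) U \<Longrightarrow> zero \<in> U \<Longrightarrow> \<exists>N\<in>\<B>. zero \<in> N \<and> N \<subseteq> U"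
    using fc zH unfolding first_countable_def by meson
  \<comment> \<open>Since \<open>N\<close> is only the trace on \<open>H\<close> of an open set,
    smallness is claimed just for those values that lie in \<open>H\<close>.\<close>
  have "\<exists>V. openin T V \<and> zero \<in> V \<and>
      (\<forall>w\<in>V. \<forall>u\<in>V. \<forall>v\<in>V. \<forall>x\<in>topspace T. \<forall>y\<in>topspace T.
        neg w \<oplus> gyr x y (neg u \<oplus> v) \<in> H \<longrightarrow> neg w \<oplus> gyr x y (neg u \<oplus> v) \<in> N)"
    if N: "N \<in> \<B>" "zero \<in> N" for N
  proof -
    obtain O1 where "openin T O1" "N = O1 \<inter> H"
      using \<B>(2)[OF N(1)] unfolding openin_subtopology by blast
    with N(2) show ?thesis
      using invariant_difference_neighbourhood[of O1] by (metis IntD1 IntI)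
  qed
  then obtain V where V: "\<And>N. N \<in> \<B> \<Longrightarrow> zero \<in> N \<Longrightarrow> openin T (V N) \<and> zero \<in> V N"
    and small: "\<And>N w u v x y. \<lbrakk>N \<in> \<B>; zero \<in> N; w \<in> V N; u \<in> V N; v \<in> V N;
        x \<in> topspace T; y \<in> topspace T; neg w \<oplus> gyr x y (neg u \<oplus> v) \<in> H\<rbrakk>
        \<Longrightarrow> neg w \<oplus> gyr x y (neg u \<oplus> v) \<in> N"
    by metis
  \<comment> \<open>The translate of \<open>V N\<close> by \<open>b\<close> is written as a preimage
    under translation by \<open>neg b\<close>.\<close>
  define net where
    "net = (\<lambda>(Q, b, N). {y \<in> topspace T. ?\<pi> y \<in> Q \<and> neg b \<oplus> y \<in> V N})"
  let ?\<N> = "net ` (\<P> \<times> B \<times> \<B>)"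
  have net: "\<exists>M\<in>?\<N>. x \<in> M \<and> M \<subseteq> U" if x: "x \<in> topspace T" and nb: "neighbourhood T x U" for x U
  proof -
    obtain U' where U': "openin T U'" "x \<in> U'" "U' \<subseteq> U"
      using nb unfolding neighbourhood_def by blast
    obtain W where W: "openin T W" "zero \<in> W"
      and sum: "\<And>u v. u \<in> W \<Longrightarrow> v \<in> W \<Longrightarrow> x \<oplus> (u \<oplus> v) \<in> U'"
      using add_add_neighbourhood[OF U'(1,2)] by blast
    have "openin (subtopology T H) (W \<inter> H)" "zero \<in> W \<inter> H"
      using W zH by (auto simp: openin_subtopology)
    then obtain N where N: "N \<in> \<B>" "zero \<in> N" "N \<subseteq> W \<inter> H"
      using base by meson
    have VN: "openin T (V N)" "zero \<in> V N"
      using V N by auto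
    \<comment> \<open>The requirement that \<open>b\<close> translate \<open>V N\<close> over
      \<open>x\<close> is an open condition on \<open>b\<close>, satisfied by \<open>b = x\<close>;
      density therefore provides such a \<open>b\<close> in \<open>B\<close>.\<close>
    have "openin T {b \<in> topspace T. neg b \<oplus> x \<in> V N}"
      using x by (intro openin_continuous_map_preimage[OF _ VN(1)] continuous_map_add continuous_map_neg)
        auto
    moreover have "x \<in> {b \<in> topspace T. neg b \<oplus> x \<in> V N}"
      using x VN(2) neg_inverse by simp
    ultimately obtain b where b: "b \<in> B" "b \<in> topspace T" "neg b \<oplus> x \<in> V N"
      using Bd by blast
    \<comment> \<open>The factor \<open>W\<close> serves the final sum estimate, and
      \<open>V N\<close> makes the bound \<open>small\<close> applicable to
      \<open>w\<close>.\<close>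
    let ?O = "{y \<in> topspace T. neg x \<oplus> y \<in> W \<inter> V N}"
    have "openin T ?O" "x \<in> ?O"
      using x W VN openin_left_translate[OF x, of "W \<inter> V N"] neg_inverse by auto
    then have "openin (coset_space T add H) (?\<pi> ` ?O)" "?\<pi> x \<in> ?\<pi> ` ?O"
      using openin_coset_space_image[OF H] by blast+
    then have "neighbourhood (coset_space T add H) (?\<pi> x) (?\<pi> ` ?O)"
      unfolding neighbourhood_def using openin_subset by blast
    moreover have "?\<pi> x \<in> topspace (coset_space T add H)"
      using x by (simp add: topspace_coset_space)
    ultimately obtain Q where Q: "Q \<in> \<P>" "?\<pi> x \<in> Q" "Q \<subseteq> ?\<pi> ` ?O"
      using P(2) unfolding network_def by blast
    have "y \<in> U" if y: "y \<in> topspace T" "?\<pi> y \<in> Q" "neg b \<oplus> y \<in> V N" for y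
    proof -
      obtain c where c: "c \<in> topspace T" "neg x \<oplus> c \<in> W \<inter> V N" "?\<pi> y = ?\<pi> c"
        using y(2) Q(3) by blast
      define w where "w = neg x \<oplus> c"
      have w: "w \<in> topspace T" "w \<in> W" "w \<in> V N" "c = x \<oplus> w"
        using c x by (auto simp: w_def add_closed neg_closed add_neg_cancel)
      have "y \<in> ?\<pi> (x \<oplus> w)"
        using mem_left_coset_self[OF sub(1) y(1)] c(3) w(4) by simp
      then obtain h0 where "h0 \<in> H" "y = (x \<oplus> w) \<oplus> h0"
        unfolding left_coset_def by auto
      then obtain h where h: "h \<in> H" "y = x \<oplus> (w \<oplus> h)"
        using add_assoc_gyr_preimage[OF x w(1) sub(2) Hinv[OF x w(1)]] by metis
      have hT: "h \<in> topspace T"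
        using h(1) sub(2) by blast
      define u v where "u = neg b \<oplus> x" and "v = neg b \<oplus> y"
      have u: "u \<in> topspace T" "x = b \<oplus> u" and v: "v \<in> topspace T" "y = b \<oplus> v"
        using x y(1) b(2) by (auto simp: u_def v_def add_closed neg_closed add_neg_cancel)
      \<comment> \<open>Both sides added to \<open>x\<close> give \<open>y\<close>: the left through
        the coset of \<open>x \<oplus> w\<close>, the right by reassociating
        \<open>b \<oplus> (u \<oplus> (neg u \<oplus> v))\<close>.\<close>
      have "w \<oplus> h = gyr b u (neg u \<oplus> v)"
      proof (rule left_cancel[OF x])
        have "x \<oplus> gyr b u (neg u \<oplus> v) = b \<oplus> (u \<oplus> (neg u \<oplus> v))"
          using gyr_assoc[OF b(2) u(1), of "neg u \<oplus> v"] u v by (simp add: add_closed neg_closed)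
        also have "\<dots> = y"
          using u(1) v add_neg_cancel by simp
        finally show "x \<oplus> (w \<oplus> h) = x \<oplus> gyr b u (neg u \<oplus> v)"
          using h(2) by simp
      qed (use w hT b u v in \<open>auto intro!: add_closed neg_closed gyr_closed\<close>)
      then have "h = neg w \<oplus> gyr b u (neg u \<oplus> v)"
        using neg_add_cancel[OF w(1) hT] by simp
      \<comment> \<open>Membership of \<open>h\<close> in \<open>H\<close> activates the bound
        \<open>small\<close>; as \<open>N \<subseteq> W\<close>, both summands of
        \<open>w \<oplus> h\<close> then lie in \<open>W\<close>.\<close>
      then have "h \<in> N"
        using small[OF N(1,2) w(3) b(3) y(3) b(2) u(1)] h(1) by (simp add: u_def v_def)
      then show "y \<in> U"
        using sum[OF w(2)] N(3) h(2) U'(3) by blast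
    qed
    then have "net (Q, b, N) \<subseteq> U"
      by (auto simp: net_def)
    moreover have "x \<in> net (Q, b, N)"
      using x Q(2) b(3) by (simp add: net_def)
    ultimately show ?thesis
      using Q(1) b(1) N(1) by blast
  qed
  have "network T ?\<N>"
    unfolding network_def by (intro conjI ballI allI impI net) (auto simp: net_def)
  moreover have "countable ?\<N>"
    using P(1) B(1) \<B>(1) by simp
  ultimately show ?thesis
    by (intro exI[of _ ?\<N>] conjI)
qed

end

theorem corollary6p9:
  fixes T :: "'a topology"
    and add :: "'a \<Rightarrow> 'a \<Rightarrow> 'a"
    and zero :: 'a
    and neg :: "'a \<Rightarrow> 'a"
    and gyr :: "'a \<Rightarrow> 'a \<Rightarrow> 'a \<Rightarrow> 'a"
    and H :: "'a set"
  assumes "strongly_topological_gyrogroup T add zero neg gyr"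
    and "strong_subgyrogroup (topspace T) add gyr H"
    and "closedin T H"
    and "first_countable (subtopology T H)"
    and "separable_space (subtopology T H)"
    and "cosmic_space (coset_space T add H)"
  shows "cosmic_space T"
proof -
  interpret strongly_topological_gyrogroup T add zero neg gyr
    by (rule assms(1))
  show ?thesis
    using assms(6) coset_space_countable_network[OF assms(2,4,5)] Hausdorff regular_space
    unfolding cosmic_space_def by blast
qed

end
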